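(* Let $\mu > 0$, let $\mathbf{A} \in \mathbb{R}^{m \times d}$ be such that $\mathbf{A}^\top \mathbf{A} \succ 0$, let $b \in \mathbb{R}^m$, and let $f(x) = \mathrm{smax}_\mu(\mathbf{A}x - b)$ for $x \in \mathbb{R}^d$. Then $f$ is (order 3) $\frac{15}{\mu^3}$-smooth with respect to $\|\cdot\|_{\mathbf{A}^\top \mathbf{A}}$.
   Context: For $z \in \mathbb{R}^m$, $\mathrm{smax}_\mu(z) = \mu \log\left(\sum_{i=1}^m e^{z_i/\mu}\right)$. For a symmetric positive-definite matrix $\mathbf{B} \in \mathbb{R}^{d \times d}$ (written $\mathbf{B} \succ 0$), $\|v\|_{\mathbf{B}} = \sqrt{v^\top \mathbf{B} v}$. For $p \geq 1$, a $p$-times differentiable function $f : \mathbb{R}^d \to \mathbb{R}$ is $L_p$-smooth (of order $p$) with respect to $\|\cdot\|_{\mathbf{B}}$ if for all $x, y \in \mathbb{R}^d$, $\|\nabla^p f(y) - \nabla^p f(x)\|_{\mathbf{B}}^* \leq L_p \|y - x\|_{\mathbf{B}}$, where $\|\nabla^p f(y) - \nabla^p f(x)\|_{\mathbf{B}}^* = \max_{h : \|h\|_{\mathbf{B}} \leq 1} \left|\nabla^p f(y)[h]^p - \nabla^p f(x)[h]^p\right|$ and $\nabla^p f(x)[h]^p = \nabla^p f(x)[h, \dots, h]$ ($p$ times). *)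

theory Defs
  imports "HOL-Analysis.Analysis"
begin

definition pos_def_matrix :: "real ^ 'd ^ 'd \<Rightarrow> bool" where
  "pos_def_matrix B \<longleftrightarrow> transpose B = B \<and> (\<forall>v. v \<noteq> 0 \<longrightarrow> 0 < v \<bullet> (B *v v))"

definition mat_norm :: "real ^ 'd ^ 'd \<Rightarrow> real ^ 'd \<Rightarrow> real" where
  "mat_norm B v = sqrt (v \<bullet> (B *v v))"

definition smax :: "real \<Rightarrow> real ^ 'm \<Rightarrow> real" where
  "smax \<mu> z = \<mu> * ln (\<Sum>i\<in>UNIV. exp (z $ i / \<mu>))"

text \<open>
  The derivative of order \<open>p\<close> is represented as a multilinear form on the list of its \<open>p\<close>
  arguments, so that the order can be a natural number rather than part of a type:
  \<open>nth_derivative f [h\<^sub>1, \<dots>, h\<^sub>p] x\<close> is the \<open>p\<close>-th derivative of \<open>f\<close> at \<open>x\<close> evaluated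
  on \<open>h\<^sub>1, \<dots>, h\<^sub>p\<close>, obtained by differentiating
  \<open>y \<mapsto> nth_derivative f [h\<^sub>2, \<dots>, h\<^sub>p] y\<close> at \<open>x\<close> in the direction \<open>h\<^sub>1\<close>.
\<close>

primrec nth_derivative ::
    "(real ^ 'd \<Rightarrow> real) \<Rightarrow> (real ^ 'd) list \<Rightarrow> real ^ 'd \<Rightarrow> real" where
  "nth_derivative f [] = f"
| "nth_derivative f (h # hs) = (\<lambda>x. frechet_derivative (nth_derivative f hs) (at x) h)"

text \<open>
  As the domain is finite-dimensional, a map into multilinear forms is Frechet differentiable
  iff its evaluation on each fixed list of arguments is.
\<close>

definition times_differentiable :: "nat \<Rightarrow> (real ^ 'd \<Rightarrow> real) \<Rightarrow> bool" where
  "times_differentiable p f \<longleftrightarrow>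
     (\<forall>hs. length hs < p \<longrightarrow> (\<forall>x. nth_derivative f hs differentiable (at x)))"

text \<open>
  The dual norm of the difference of the \<open>p\<close>-th derivatives of \<open>f\<close> at \<open>y\<close> and \<open>x\<close>. If \<open>f\<close> is
  \<open>p\<close> times differentiable and \<open>B\<close> is positive definite, this is the supremum of a continuous
  function over a nonempty compact set, hence a maximum.
\<close>

definition derivative_dual_dist ::
    "nat \<Rightarrow> real ^ 'd ^ 'd \<Rightarrow> (real ^ 'd \<Rightarrow> real) \<Rightarrow> real ^ 'd \<Rightarrow> real ^ 'd \<Rightarrow> real" where
  "derivative_dual_dist p B f y x =
     (SUP h\<in>{h. mat_norm B h \<le> 1}.
        \<bar>nth_derivative f (replicate p h) y - nth_derivative f (replicate p h) x\<bar>)"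

definition smooth_of_order ::
    "nat \<Rightarrow> real \<Rightarrow> real ^ 'd ^ 'd \<Rightarrow> (real ^ 'd \<Rightarrow> real) \<Rightarrow> bool" where
  "smooth_of_order p L B f \<longleftrightarrow>
     times_differentiable p f \<and>
     (\<forall>x y. derivative_dual_dist p B f y x \<le> L * mat_norm B (y - x))"

end

theory Submission
  imports Defs
begin

text \<open>
  The derivatives of the soft maximum are cumulants of the softmax distribution on the coordinates.
  Writing \<open>u = A h\<close>, \<open>w = A k\<close> and marking centred variables by a prime, the third derivative in
  direction \<open>h\<close> is \<open>E[u'\<^sup>3] / \<mu>\<^sup>2\<close>, and its derivative in direction \<open>k\<close> is
  \<open>E[(u'\<^sup>2 - 3 Var u) u' w'] / \<mu>\<^sup>3\<close>. If \<open>norm u \<le> 1\<close>, then both \<open>u'\<^sup>2\<close> and \<open>3 Var u\<close> lie in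
  \<open>[0, 4]\<close>, so by Cauchy--Schwarz this is at most \<open>4 norm w / \<mu>\<^sup>3\<close>. The mean value theorem then
  gives a Lipschitz constant \<open>4 / \<mu>\<^sup>3\<close>.
\<close>

section \<open>Expectations under the softmax distribution\<close>

text \<open>Written as one quotient of exponential sums, so that the quotient rule applies to it
  directly.\<close>

definition softmax_mean :: "real \<Rightarrow> real ^ 'm \<Rightarrow> ('m \<Rightarrow> real) \<Rightarrow> real" where
  "softmax_mean \<mu> z g = (\<Sum>i\<in>UNIV. exp (z $ i / \<mu>) * g i) / (\<Sum>i\<in>UNIV. exp (z $ i / \<mu>))"

lemma sum_exp_pos:
  fixes z :: "real ^ 'm"
  shows "(\<Sum>i\<in>UNIV. exp (z $ i / \<mu>)) > 0"
  by (intro sum_pos) auto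

text \<open>Strips the exponentials away: the moment inequality sees only nonnegative weights of
  total 1.\<close>

lemma softmax_mean_eq_weighted_sum:
  fixes z :: "real ^ 'm"
  obtains p where "\<And>i. p i \<ge> 0" "(\<Sum>i\<in>UNIV. p i) = 1"
    "\<And>g. softmax_mean \<mu> z g = (\<Sum>i\<in>UNIV. p i * g i)"
proof
  let ?Z = "\<Sum>i\<in>UNIV. exp (z $ i / \<mu>)"
  show "exp (z $ i / \<mu>) / ?Z \<ge> 0" for i
    using sum_exp_pos[of z \<mu>] by simp
  show "(\<Sum>i\<in>UNIV. exp (z $ i / \<mu>) / ?Z) = 1"
    using sum_exp_pos[of z \<mu>] by (simp flip: sum_divide_distrib)
  show "softmax_mean \<mu> z g = (\<Sum>i\<in>UNIV. exp (z $ i / \<mu>) / ?Z * g i)" for g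
    by (simp add: softmax_mean_def sum_divide_distrib)
qed

section \<open>Differentiation of softmax expectations along an affine map\<close>

lemma has_derivative_affine_component:
  fixes A :: "real ^ 'd ^ 'm"
  shows "((\<lambda>x. (A *v x - b) $ i) has_derivative (\<lambda>k. (A *v k) $ i)) (at x)"
  by (auto intro!: derivative_eq_intros bounded_linear_imp_has_derivative
      bounded_linear_compose[OF bounded_linear_vec_nth] matrix_vector_mul_bounded_linear)

lemma has_derivative_sum_exp_affine:
  fixes A :: "real ^ 'd ^ 'm"
  shows "((\<lambda>x. \<Sum>i\<in>UNIV. exp ((A *v x - b) $ i / \<mu>) * g i) has_derivative
    (\<lambda>k. (\<Sum>i\<in>UNIV. exp ((A *v x - b) $ i / \<mu>) * (g i * (A *v k) $ i)) / \<mu>)) (at x)"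
proof -
  have "((\<lambda>x. exp ((A *v x - b) $ i / \<mu>) * g i) has_derivative
    (\<lambda>k. exp ((A *v x - b) $ i / \<mu>) * ((A *v k) $ i / \<mu>) * g i)) (at x)" for i
  proof -
    have "((\<lambda>x. (A *v x - b) $ i / \<mu>) has_derivative (\<lambda>k. (A *v k) $ i / \<mu>)) (at x)"
      by (rule bounded_linear.has_derivative[OF bounded_linear_divide has_derivative_affine_component])
    from has_derivative_mult_left[OF has_derivative_exp[OF this], of "g i"] show ?thesis
      by (simp add: mult_ac)
  qed
  then show ?thesis
    by (intro has_derivative_eq_rhs[OF has_derivative_sum]) (auto simp: sum_divide_distrib mult_ac)
qed

lemma has_derivative_smax_affine:
  fixes A :: "real ^ 'd ^ 'm"
  assumes "\<mu> \<noteq> 0"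
  shows "((\<lambda>x. smax \<mu> (A *v x - b)) has_derivative
    (\<lambda>k. softmax_mean \<mu> (A *v x - b) (\<lambda>i. (A *v k) $ i))) (at x)"
proof -
  \<comment> \<open>The weight \<open>g = 1\<close> gives the derivative of the normalizing sum
    itself.\<close>
  note D = has_derivative_sum_exp_affine[of A b \<mu> "\<lambda>_. 1", unfolded mult_1_left mult_1_right]
  have "((\<lambda>x. \<mu> * ln (\<Sum>i\<in>UNIV. exp ((A *v x - b) $ i / \<mu>))) has_derivative
    (\<lambda>k. \<mu> * ((\<Sum>i\<in>UNIV. exp ((A *v x - b) $ i / \<mu>) * (A *v k) $ i) / \<mu>
      * inverse (\<Sum>i\<in>UNIV. exp ((A *v x - b) $ i / \<mu>))))) (at x)"
    by (intro has_derivative_mult_right has_derivative_ln D sum_exp_pos)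
  moreover have "\<mu> * (P / \<mu> * inverse Z) = P / Z" for P Z
    using assms by (simp add: divide_inverse)
  ultimately show ?thesis
    unfolding smax_def softmax_mean_def by (simp only:)
qed

text \<open>By the quotient rule, differentiating an expectation in direction \<open>k\<close>
  yields the covariance of \<open>g\<close> with \<open>A *v k\<close>, divided by
  \<open>\<mu>\<close>. Every higher derivative comes from iterating this rule.\<close>

lemma has_derivative_softmax_mean_affine:
  fixes A :: "real ^ 'd ^ 'm"
  shows "((\<lambda>x. softmax_mean \<mu> (A *v x - b) g) has_derivative
    (\<lambda>k. (softmax_mean \<mu> (A *v x - b) (\<lambda>i. g i * (A *v k) $ i) -
      softmax_mean \<mu> (A *v x - b) g * softmax_mean \<mu> (A *v x - b) (\<lambda>i. (A *v k) $ i)) / \<mu>)) (at x)"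
proof -
  note D1 = has_derivative_sum_exp_affine[of A b \<mu> "\<lambda>_. 1", unfolded mult_1_left mult_1_right]
  note D = has_derivative_sum_exp_affine[of A b \<mu> g]
  have Z: "(\<Sum>i\<in>UNIV. exp ((A *v x - b) $ i / \<mu>)) \<noteq> 0"
    using sum_exp_pos[of "A *v x - b" \<mu>] by simp
  have quotient: "(P / \<mu> * Z - Q * (R / \<mu>)) / (Z * Z) = (P / Z - Q / Z * (R / Z)) / \<mu>"
    if "Z \<noteq> 0" for P Q R Z :: real
    \<comment> \<open>At \<open>\<mu> = 0\<close> both sides are 0, since division by 0 yields
      0.\<close>
    using that by (cases "\<mu> = 0") (auto simp: field_simps)
  show ?thesis
    unfolding softmax_mean_def
    by (rule has_derivative_eq_rhs[OF has_derivative_divide'[OF D D1 Z]]) (simp only: quotient[OF Z])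
qed

section \<open>A bound on a fourth joint cumulant\<close>

text \<open>The expression is the joint cumulant of \<open>u, u, u, w\<close> in raw moments,
  grouped into covariances with \<open>w\<close> exactly as they arise when the third cumulant of
  \<open>u\<close> is differentiated.\<close>

lemma weighted_fourth_cumulant_bound:
  fixes p u w :: "'i \<Rightarrow> real"
  assumes p: "\<And>i. i \<in> I \<Longrightarrow> p i \<ge> 0" "(\<Sum>i\<in>I. p i) = 1"
    and u: "\<And>i. i \<in> I \<Longrightarrow> \<bar>u i\<bar> \<le> 1" and w: "\<And>i. i \<in> I \<Longrightarrow> \<bar>w i\<bar> \<le> W"
  defines "E \<equiv> \<lambda>g. \<Sum>i\<in>I. p i * g i"
  shows "\<bar>(E (\<lambda>i. u i ^ 3 * w i) - E (\<lambda>i. u i ^ 3) * E w)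
    - 3 * E u * (E (\<lambda>i. u i ^ 2 * w i) - E (\<lambda>i. u i ^ 2) * E w)
    + (6 * E u ^ 2 - 3 * E (\<lambda>i. u i ^ 2)) * (E (\<lambda>i. u i * w i) - E u * E w)\<bar> \<le> 4 * W"
proof -
  have E_add: "E (\<lambda>i. f i + g i) = E f + E g" for f g
    by (simp add: E_def algebra_simps sum.distrib)
  have E_diff: "E (\<lambda>i. f i - g i) = E f - E g" for f g
    by (simp add: E_def algebra_simps sum_subtractf)
  have E_cmult: "E (\<lambda>i. c * f i) = c * E f" for c f
    by (simp add: E_def sum_distrib_left algebra_simps)
  have E_const: "E (\<lambda>_. c) = c" for c
    using p(2) by (simp add: E_def flip: sum_distrib_right)
  have E_mono: "E f \<le> E g" if "\<And>i. i \<in> I \<Longrightarrow> f i \<le> g i" for f g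
    unfolding E_def by (intro sum_mono mult_left_mono that p(1))
  have E_abs: "\<bar>E f\<bar> \<le> E (\<lambda>i. \<bar>f i\<bar>)" for f
    unfolding E_def
    by (rule order_trans[OF sum_abs]) (auto intro!: sum_mono simp: abs_mult p(1))
  have "I \<noteq> {}"
    using p(2) by auto
  then have "W \<ge> 0"
    using w by fastforce
  define u' where "u' i = u i - E u" for i
  define w' where "w' i = w i - E w" for i
  define v where "v = E (\<lambda>i. u' i ^ 2)"
  have variance: "E (\<lambda>i. (g i - E g) ^ 2) = E (\<lambda>i. g i ^ 2) - E g ^ 2" for g
  proof -
    have "E (\<lambda>i. (g i - E g) ^ 2) = E (\<lambda>i. g i ^ 2 - 2 * E g * g i + E g ^ 2)"
      by (simp add: power2_eq_square algebra_simps)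
    then show ?thesis
      by (simp add: E_add E_diff E_cmult E_const power2_eq_square)
  qed
  have variance_le: "E (\<lambda>i. (g i - E g) ^ 2) \<le> B ^ 2" if "\<And>i. i \<in> I \<Longrightarrow> \<bar>g i\<bar> \<le> B" for g B
  proof -
    have "E (\<lambda>i. g i ^ 2) \<le> E (\<lambda>_. B ^ 2)"
      by (rule E_mono) (metis abs_ge_zero power2_abs power_mono that)
    then show ?thesis
      unfolding variance E_const by (smt (verit) zero_le_power2)
  qed
  have v1: "v \<le> 1"
    using variance_le[of u 1] u by (simp add: v_def u'_def)
  have v0: "v \<ge> 0"
    using p(1) by (auto simp: v_def E_def intro!: sum_nonneg)
  have w1: "E (\<lambda>i. w' i ^ 2) \<le> W ^ 2"
    using variance_le[of w W] w by (simp add: w'_def)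
  have "\<bar>E u\<bar> \<le> 1"
    using E_abs[of u] E_mono[of "\<lambda>i. \<bar>u i\<bar>" "\<lambda>_. 1"] u by (simp add: E_const)
  then have u'_le: "\<bar>u' i\<bar> \<le> 2" if "i \<in> I" for i
    using u[OF that] unfolding u'_def by linarith
  \<comment> \<open>Both terms are nonnegative, so their difference is bounded by the larger of
    their two bounds instead of the sum.\<close>
  have coeff: "\<bar>u' i ^ 2 - 3 * v\<bar> \<le> 4" if "i \<in> I" for i
  proof -
    have "u' i ^ 2 \<le> 4"
      using power_mono[OF u'_le[OF that], of 2] by simp
    then show ?thesis
      using v0 v1 zero_le_power2[of "u' i"] by linarith
  qed
  \<comment> \<open>Cauchy-Schwarz in the form \<open>2 * a * b \<le> a ^ 2 + b ^ 2\<close> with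
    \<open>a = W * \<bar>u' i\<bar>\<close> and \<open>b = \<bar>w' i\<bar>\<close>: the factor
    \<open>W\<close> makes both second moments at most \<open>W ^ 2\<close>. Cancelling
    \<open>W\<close> at the end requires \<open>W > 0\<close>; for \<open>W = 0\<close> the function
    \<open>w'\<close> vanishes on \<open>I\<close>.\<close>
  have CS: "E (\<lambda>i. \<bar>u' i * w' i\<bar>) \<le> W"
  proof (cases "W = 0")
    case True
    then have "w i = 0" if "i \<in> I" for i
      using w[OF that] by simp
    then have "\<bar>w' i\<bar> \<le> 0" if "i \<in> I" for i
      using that by (simp add: w'_def E_def)
    then show ?thesis
      using True by (simp add: E_def abs_mult)
  next
    case False
    with \<open>W \<ge> 0\<close> have "W > 0" by simp
    have "2 * W * E (\<lambda>i. \<bar>u' i * w' i\<bar>) = E (\<lambda>i. 2 * W * \<bar>u' i * w' i\<bar>)"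
      by (rule E_cmult[symmetric])
    also have "\<dots> \<le> E (\<lambda>i. W ^ 2 * u' i ^ 2 + w' i ^ 2)"
    proof (rule E_mono)
      fix i
      have "(W * \<bar>u' i\<bar> - \<bar>w' i\<bar>) ^ 2 \<ge> 0" by simp
      then show "2 * W * \<bar>u' i * w' i\<bar> \<le> W ^ 2 * u' i ^ 2 + w' i ^ 2"
        by (simp add: power2_diff power_mult_distrib abs_mult mult_ac)
    qed
    also have "\<dots> = W ^ 2 * v + E (\<lambda>i. w' i ^ 2)"
      by (simp add: E_add E_cmult v_def)
    also have "\<dots> \<le> W ^ 2 * 1 + W ^ 2"
      by (intro add_mono mult_left_mono v1 w1) auto
    finally have "2 * W * E (\<lambda>i. \<bar>u' i * w' i\<bar>) \<le> 2 * W * W"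
      by (simp add: power2_eq_square)
    then show ?thesis
      using \<open>W > 0\<close> by simp
  qed
  have v_eq: "v = E (\<lambda>i. u i ^ 2) - E u ^ 2"
    unfolding v_def u'_def by (rule variance)
  \<comment> \<open>With the means named as scalars, the centred product expands into terms to which
    linearity of \<open>E\<close> applies. The variance \<open>v\<close> stays a symbol until
    \<open>v_eq\<close> returns it to raw moments.\<close>
  define m where "m = E u"
  define c where "c = E w"
  have "(u' i ^ 2 - 3 * v) * (u' i * w' i) =
      u i ^ 3 * w i - c * u i ^ 3 - 3 * m * (u i ^ 2 * w i) + 3 * m * c * u i ^ 2
      + (3 * m ^ 2 - 3 * v) * (u i * w i) - (3 * m ^ 2 - 3 * v) * c * u i
      - (m ^ 3 - 3 * v * m) * w i + (m ^ 3 - 3 * v * m) * c" for i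
    unfolding u'_def w'_def m_def[symmetric] c_def[symmetric] by algebra
  then have "E (\<lambda>i. (u' i ^ 2 - 3 * v) * (u' i * w' i)) =
      E (\<lambda>i. u i ^ 3 * w i) - c * E (\<lambda>i. u i ^ 3) - 3 * m * E (\<lambda>i. u i ^ 2 * w i)
      + 3 * m * c * E (\<lambda>i. u i ^ 2)
      + (3 * m ^ 2 - 3 * v) * E (\<lambda>i. u i * w i) - (3 * m ^ 2 - 3 * v) * c * m
      - (m ^ 3 - 3 * v * m) * c + (m ^ 3 - 3 * v * m) * c"
    by (simp only: E_add E_diff E_cmult E_const m_def[symmetric] c_def[symmetric])
  also have "\<dots> = (E (\<lambda>i. u i ^ 3 * w i) - E (\<lambda>i. u i ^ 3) * E w)
    - 3 * E u * (E (\<lambda>i. u i ^ 2 * w i) - E (\<lambda>i. u i ^ 2) * E w)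
    + (6 * E u ^ 2 - 3 * E (\<lambda>i. u i ^ 2)) * (E (\<lambda>i. u i * w i) - E u * E w)"
    unfolding m_def[symmetric] c_def[symmetric] v_eq by algebra
  finally have eq: "\<dots> = E (\<lambda>i. (u' i ^ 2 - 3 * v) * (u' i * w' i))" by simp
  have "\<bar>E (\<lambda>i. (u' i ^ 2 - 3 * v) * (u' i * w' i))\<bar> \<le> E (\<lambda>i. \<bar>(u' i ^ 2 - 3 * v) * (u' i * w' i)\<bar>)"
    by (rule E_abs)
  also have "\<dots> \<le> E (\<lambda>i. 4 * \<bar>u' i * w' i\<bar>)"
    by (rule E_mono) (simp add: abs_mult[of "_ - _"] coeff mult_right_mono)
  also have "\<dots> \<le> 4 * W"
    using CS by (simp add: E_cmult)
  finally show ?thesis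
    unfolding eq .
qed

section \<open>The Gram norm and derivatives of the soft maximum up to order three\<close>

text \<open>Moving \<open>transpose A\<close> across the inner product makes the quadratic form the
  squared Euclidean norm of \<open>A *v v\<close>, which controls each of its coordinates.\<close>

lemma mat_norm_gram:
  fixes A :: "real ^ 'd ^ 'm"
  shows "mat_norm (transpose A ** A) v = norm (A *v v)"
proof -
  have "v \<bullet> ((transpose A ** A) *v v) = (v v* transpose A) \<bullet> (A *v v)"
    unfolding dot_lmul_matrix by (simp only: matrix_vector_mul_assoc)
  then show ?thesis
    by (simp add: mat_norm_def norm_eq_sqrt_inner vector_transpose_matrix)
qed

lemma frechet_derivative_eqI:
  "(f has_derivative f') (at x) \<Longrightarrow> frechet_derivative f (at x) = f'"
  by (rule frechet_derivative_at[symmetric])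

context
  fixes \<mu> :: real and A :: "real ^ 'd ^ 'm" and b :: "real ^ 'm"
  assumes \<mu>_pos: "\<mu> > 0"
begin

abbreviation (input) mean :: "real ^ 'd \<Rightarrow> ('m \<Rightarrow> real) \<Rightarrow> real" where
  "mean x \<equiv> softmax_mean \<mu> (A *v x - b)"

abbreviation (input) smax_affine :: "real ^ 'd \<Rightarrow> real" where
  "smax_affine \<equiv> \<lambda>x. smax \<mu> (A *v x - b)"

lemmas has_derivative_mean = has_derivative_softmax_mean_affine[of \<mu> A b]

lemma mean_differentiable: "(\<lambda>x. mean x g) differentiable at x"
  by (rule differentiableI[OF has_derivative_mean])

lemma nth_derivative_smax_affine_1:
  "nth_derivative smax_affine [h] = (\<lambda>x. mean x (\<lambda>i. (A *v h) $ i))"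
  using frechet_derivative_eqI[OF has_derivative_smax_affine[of \<mu> A b]] \<mu>_pos by simp

text \<open>This is a covariance over \<open>\<mu>\<close>. The direction \<open>k\<close> comes
  first in the products because the last list entry is differentiated first.\<close>

lemma nth_derivative_smax_affine_2:
  "nth_derivative smax_affine [h, k] =
    (\<lambda>x. (mean x (\<lambda>i. (A *v k) $ i * (A *v h) $ i)
       - mean x (\<lambda>i. (A *v k) $ i) * mean x (\<lambda>i. (A *v h) $ i)) / \<mu>)"
  unfolding nth_derivative.simps(2)[of _ h] nth_derivative_smax_affine_1
  by (simp add: frechet_derivative_eqI[OF has_derivative_mean])

lemma times_differentiable_smax_affine: "times_differentiable 3 smax_affine"
  unfolding times_differentiable_def
proof (intro allI impI)
  fix hs :: "(real ^ 'd) list" and x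
  assume "length hs < 3"
  \<comment> \<open>Differentiability of order 3 requires the derivatives of orders 0, 1 and 2 to be
    differentiable.\<close>
  then consider "hs = []" | h where "hs = [h]" | h k where "hs = [h, k]"
    by (auto simp: numeral_3_eq_3 less_Suc_eq length_Suc_conv)
  then show "nth_derivative smax_affine hs differentiable at x"
  proof cases
    case 1
    then show ?thesis
      using differentiableI[OF has_derivative_smax_affine[of \<mu> A b]] \<mu>_pos by simp
  next
    case 2
    show ?thesis
      unfolding \<open>hs = _\<close> nth_derivative_smax_affine_1
      by (rule mean_differentiable)
  next
    case 3
    show ?thesis
      unfolding \<open>hs = _\<close> nth_derivative_smax_affine_2
      unfolding divide_inverse
      by (intro differentiable_mult differentiable_diff differentiable_const mean_differentiable)
  qed
qed

text \<open>The third cumulant is kept in raw moments because the rule for \<open>mean\<close>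
  differentiates expectations of a fixed function, whereas centred variables change with
  \<open>x\<close>.\<close>

lemma nth_derivative_smax_affine_3:
  fixes h :: "real ^ 'd"
  defines "u \<equiv> \<lambda>i. (A *v h) $ i"
  shows "nth_derivative smax_affine (replicate 3 h) =
    (\<lambda>x. (mean x (\<lambda>i. u i ^ 3) - 3 * mean x (\<lambda>i. u i ^ 2) * mean x u + 2 * mean x u ^ 3) / \<mu> ^ 2)"
proof
  fix x
  let ?M = "\<lambda>n. mean x (\<lambda>i. u i ^ n)"
  have "((\<lambda>x. (mean x (\<lambda>i. u i ^ 2) - mean x u ^ 2) / \<mu>) has_derivative
    (\<lambda>k. ((mean x (\<lambda>i. u i ^ 2 * (A *v k) $ i) - ?M 2 * mean x (\<lambda>i. (A *v k) $ i)) / \<mu>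
      - 2 * mean x u * ((mean x (\<lambda>i. u i * (A *v k) $ i) - mean x u * mean x (\<lambda>i. (A *v k) $ i)) / \<mu>)) / \<mu>)) (at x)"
    using \<mu>_pos by (auto intro!: derivative_eq_intros has_derivative_mean)
  note D = frechet_derivative_eqI[OF this]
  have 2: "nth_derivative smax_affine [h, h] = (\<lambda>x. (mean x (\<lambda>i. u i ^ 2) - mean x u ^ 2) / \<mu>)"
    unfolding nth_derivative_smax_affine_2 u_def by (simp add: power2_eq_square)
  have "nth_derivative smax_affine (replicate 3 h) x =
      frechet_derivative (nth_derivative smax_affine [h, h]) (at x) h"
    by (simp add: numeral_3_eq_3)
  also have "\<dots> = ((?M 3 - ?M 2 * mean x u) / \<mu> - 2 * mean x u * ((?M 2 - mean x u * mean x u) / \<mu>)) / \<mu>"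
    unfolding 2 D u_def[symmetric]
    by (simp only: power2_eq_square[symmetric] power_Suc2[symmetric] Suc_numeral semiring_norm)
  also have "\<dots> = (?M 3 - 3 * ?M 2 * mean x u + 2 * mean x u ^ 3) / \<mu> ^ 2"
  proof -
    have "((a - b * c) / \<mu> - 2 * c * ((b - c * c) / \<mu>)) / \<mu> = (a - 3 * b * c + 2 * c ^ 3) / \<mu> ^ 2"
      for a b c
      using \<mu>_pos by (simp add: field_simps power2_eq_square power3_eq_cube)
    then show ?thesis .
  qed
  finally show "nth_derivative smax_affine (replicate 3 h) x =
      (?M 3 - 3 * ?M 2 * mean x u + 2 * mean x u ^ 3) / \<mu> ^ 2" .
qed

section \<open>Lipschitz estimate for the third derivative\<close>

text \<open>For fixed \<open>h\<close>, the mean value theorem on the segment from \<open>x\<close>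
  to \<open>y\<close> reduces the claim to a bound on the directional derivative that is uniform in
  the base point.\<close>

lemma third_derivative_smax_affine_lipschitz:
  assumes h: "norm (A *v h) \<le> 1"
  shows "\<bar>nth_derivative smax_affine (replicate 3 h) y - nth_derivative smax_affine (replicate 3 h) x\<bar>
    \<le> 4 / \<mu> ^ 3 * norm (A *v (y - x))"
proof -
  define u where "u i = (A *v h) $ i" for i
  define w where "w i = (A *v (y - x)) $ i" for i
  define F where "F = nth_derivative smax_affine (replicate 3 h)"
  have F: "F = (\<lambda>x. (mean x (\<lambda>i. u i ^ 3) - 3 * mean x (\<lambda>i. u i ^ 2) * mean x u
      + 2 * mean x u ^ 3) / \<mu> ^ 2)"
    unfolding F_def nth_derivative_smax_affine_3 u_def ..
  \<comment> \<open>The cumulant expression of \<open>weighted_fourth_cumulant_bound\<close>.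
    Differentiating a mean contributes one more factor \<open>1 / \<mu>\<close>, hence
    \<open>\<mu> ^ 3\<close> in \<open>F_deriv\<close>.\<close>
  define K where "K z k = (mean z (\<lambda>i. u i ^ 3 * k i) - mean z (\<lambda>i. u i ^ 3) * mean z k)
    - 3 * mean z u * (mean z (\<lambda>i. u i ^ 2 * k i) - mean z (\<lambda>i. u i ^ 2) * mean z k)
    + (6 * mean z u ^ 2 - 3 * mean z (\<lambda>i. u i ^ 2)) * (mean z (\<lambda>i. u i * k i) - mean z u * mean z k)"
    for z k
  have F_deriv: "(F has_derivative (\<lambda>k. K z (\<lambda>i. (A *v k) $ i) / \<mu> ^ 3)) (at z)" for z
    unfolding F
    by (rule derivative_eq_intros has_derivative_mean refl)+
       (use \<mu>_pos in \<open>auto simp: K_def field_simps power2_eq_square power3_eq_cube\<close>)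
  have K_bound: "\<bar>K z w\<bar> \<le> 4 * norm (A *v (y - x))" for z
  proof -
    obtain p where p: "\<And>i. p i \<ge> 0" "(\<Sum>i\<in>UNIV. p i) = 1"
      and mean: "\<And>g. mean z g = (\<Sum>i\<in>UNIV. p i * g i)"
      using softmax_mean_eq_weighted_sum by blast
    have "\<bar>u i\<bar> \<le> 1" "\<bar>w i\<bar> \<le> norm (A *v (y - x))" for i
      using h component_le_norm_cart[of "A *v h" i] component_le_norm_cart[of "A *v (y - x)" i]
      by (auto simp: u_def w_def)
    then show ?thesis
      unfolding K_def mean by (intro weighted_fourth_cumulant_bound p)
  qed
  have "((\<lambda>t. F (x + t *\<^sub>R (y - x))) has_real_derivative K (x + t *\<^sub>R (y - x)) w / \<mu> ^ 3) (at t)" for t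
  proof -
    have ratio: "(*) (a / c) = (\<lambda>s. a * s / c)" for a c :: real
      by auto
    have "((\<lambda>t. F (x + t *\<^sub>R (y - x))) has_derivative
        (\<lambda>s. K (x + t *\<^sub>R (y - x)) (\<lambda>i. (A *v (s *\<^sub>R (y - x))) $ i) / \<mu> ^ 3)) (at t)"
      by (rule has_derivative_compose[OF _ F_deriv]) (auto intro!: derivative_eq_intros)
    moreover have "K z (\<lambda>i. (A *v (s *\<^sub>R (y - x))) $ i) = K z w * s" for z s
    proof -
      \<comment> \<open>Taking \<open>g\<close> as a power of \<open>u\<close> or as 1 covers every
        occurrence of the second argument of \<open>K\<close>, which is therefore linear in
        it.\<close>
      have "mean z (\<lambda>i. g i * (s * w i)) = s * mean z (\<lambda>i. g i * w i)" for g
        by (simp add: softmax_mean_def sum_distrib_left mult_ac)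
      note scale = this this[of "\<lambda>_. 1", unfolded mult_1_left]
      have "(\<lambda>i. (A *v (s *\<^sub>R (y - x))) $ i) = (\<lambda>i. s * w i)"
        unfolding w_def by (simp only: matrix_vector_mult_scaleR vector_scaleR_component real_scaleR_def)
      then show ?thesis
        unfolding K_def by (simp only: scale) (simp add: algebra_simps)
    qed
    ultimately show ?thesis
      unfolding has_field_derivative_def ratio by simp
  qed
  then have "\<exists>t>0. t < 1 \<and> F (x + 1 *\<^sub>R (y - x)) - F (x + 0 *\<^sub>R (y - x)) =
      (1 - 0) * (K (x + t *\<^sub>R (y - x)) w / \<mu> ^ 3)"
    by (intro MVT2) simp_all
  then obtain t where "F (x + 1 *\<^sub>R (y - x)) - F (x + 0 *\<^sub>R (y - x)) =
      (1 - 0) * (K (x + t *\<^sub>R (y - x)) w / \<mu> ^ 3)"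
    by blast
  then have "\<bar>F y - F x\<bar> = \<bar>K (x + t *\<^sub>R (y - x)) w\<bar> / \<mu> ^ 3"
    using \<mu>_pos by simp
  also have "\<dots> \<le> 4 * norm (A *v (y - x)) / \<mu> ^ 3"
    using K_bound \<mu>_pos by (intro divide_right_mono) auto
  finally show ?thesis
    by (simp add: F_def)
qed

end

section \<open>Passage to the dual norm\<close>

theorem theorem3p4:
  fixes \<mu> :: real
    and A :: "real ^ 'd ^ 'm"
    and b :: "real ^ 'm"
    and f :: "real ^ 'd \<Rightarrow> real"
  assumes "\<mu> > 0"
    and "pos_def_matrix (transpose A ** A)"
    and "\<And>x. f x = smax \<mu> (A *v x - b)"
  shows "smooth_of_order 3 (15 / \<mu> ^ 3) (transpose A ** A) f"
proof -
  have f: "f = (\<lambda>x. smax \<mu> (A *v x - b))"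
    using assms(3) by auto
  have "derivative_dual_dist 3 (transpose A ** A) f y x
      \<le> 15 / \<mu> ^ 3 * mat_norm (transpose A ** A) (y - x)" for x y
    unfolding derivative_dual_dist_def mat_norm_gram
  \<comment> \<open>A supremum of reals obeys a uniform bound once the index set is nonempty; the
    zero vector is the witness.\<close>
  proof (rule cSUP_least)
    have "0 \<in> {h. norm (A *v h) \<le> 1}" by simp
    then show "{h. norm (A *v h) \<le> 1} \<noteq> {}" by blast
  next
    fix h
    assume "h \<in> {h. norm (A *v h) \<le> 1}"
    then have "\<bar>nth_derivative f (replicate 3 h) y - nth_derivative f (replicate 3 h) x\<bar>
        \<le> 4 / \<mu> ^ 3 * norm (A *v (y - x))"
      unfolding f using third_derivative_smax_affine_lipschitz[OF assms(1)] by simp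
    \<comment> \<open>The estimate with 4 implies the one with 15, as the norm is
      nonnegative.\<close>
    also have "\<dots> \<le> 15 / \<mu> ^ 3 * norm (A *v (y - x))"
      using assms(1) by (intro mult_right_mono divide_right_mono) auto
    finally show "\<bar>nth_derivative f (replicate 3 h) y - nth_derivative f (replicate 3 h) x\<bar>
        \<le> 15 / \<mu> ^ 3 * norm (A *v (y - x))" .
  qed
  then show ?thesis
    unfolding smooth_of_order_def f using times_differentiable_smax_affine[OF assms(1)] by blast
qed

end
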